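(* Let $\mathbf X$ be a stationary point process on $\mathbb R^d$ belonging to a parametric family indexed by (among possibly other parameters) $\theta\in\Theta\subset\mathbb R^p$, $p\ge1$, with distribution ruled by a given $\theta_0$, assumed to be an interior point of $\Theta$. For $t\in[r_{\min},r_{\max}]$ let $J(t,\theta)$ be a real-valued summary statistic of the process depending on $\theta$, let $\widehat J_n(t)$ be an estimator of $J(t,\theta_0)$ based on the observation of $\mathbf X$ on $D_n$, and put $$U_n(\theta)=\int_{r_{\min}}^{r_{\max}}w(t)\{\widehat J_n(t)^c-J(t,\theta)^c\}^2dt.$$ Assume: ($\mathcal A1$) $\Theta$ is a compact set with non-empty interior, $0\le r_{\min}<r_{\max}$, $c\ne0$, and $\{D_n\}_{n\in\mathbb N}$ is a regular sequence of subsets of $\mathbb R^d$. ($\mathcal A2$) $w$ is a positive and integrable function on $[r_{\min},r_{\max}]$. ($\mathcal A3$) $J(\cdot,\cdot)$ and $J(\cdot,\cdot)^c$ are well defined continuous functions on $[r_{\min},r_{\max}]\times\Theta$. Moreover, there exists a set $A\subset[r_{\min},r_{\max}]$ such that $[r_{\min},r_{\max}]\setminus A$ is Lebesgue-null and $J(t,\theta)>0$ for all $t\in A$, $\theta\in\Theta$. ($\mathcal A4$) There exists $n_0\in\mathbb N$ such that for all $n\ge n_0$, $\widehat J_n(\cdot)$ and $\widehat J_n(\cdot)^c$ are almost surely bounded on $[r_{\min},r_{\max}]$. ($\mathcal A5$) There exists a set $A\subset[r_{\min},r_{\max}]$ such that $[r_{\min},r_{\max}]\setminus A$ is Lebesgue-null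 and $\sup_{t\in A}|\widehat J_n(t)-J(t,\theta_0)|\to0$ in probability as $n\to+\infty$. ($\mathcal A6$) For $\theta_1\ne\theta_2$, there exists a set $A$ of positive Lebesgue measure such that $J(t,\theta_1)\neq J(t,\theta_2)$ for all $t\in A$. Then the minimum contrast estimator $$\widetilde\theta_n=\operatorname*{arg\,min}_{\theta\in\Theta}U_n(\theta)$$ exists almost surely and is consistent for $\theta_0$; it is strongly consistent if ($\mathcal A5$) holds with almost sure convergence in place of convergence in probability.
   Context: A sequence $\{D_n\}$ of subsets of $\mathbb R^d$ is regular if $D_n\subset D_{n+1}$, $D_n$ is compact and convex, and there are constants $\alpha_1,\alpha_2$ (positive) with $\alpha_1n^d\le|D_n|\le\alpha_2n^d$ and $\alpha_1n^{d-1}\le\mathcal H_{d-1}(\partial D_n)\le\alpha_2n^{d-1}$, where $|\cdot|$ is Lebesgue measure and $\mathcal H_{d-1}$ the $(d-1)$-dimensional Hausdorff measure. In ($\mathcal A6$), $\theta_1,\theta_2\in\Theta$ and $A\subset[r_{\min},r_{\max}]$. Consistent means convergence in probability of $\widetilde\theta_n$ to $\theta_0$; strongly consistent means almost sure convergence. *)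

theory Defs
  imports "HOL-Probability.Probability"
begin

section \<open>Hausdorff measure and regular sequences of domains\<close>

text \<open>The normalisation is the usual one, for which the \<open>d\<close>-dimensional Hausdorff measure on
  \<open>d\<close>-dimensional space is Lebesgue measure. The test for the empty set only matters
  for \<open>k = 0\<close>, where \<open>0 ^ 0 = 1\<close> makes nonempty sets count 1.\<close>

definition hausdorff_measure :: "nat \<Rightarrow> 'a::metric_space set \<Rightarrow> ennreal" where
  "hausdorff_measure k A =
    (SUP \<delta>\<in>{0<..}. INF U\<in>{U :: nat \<Rightarrow> 'a set. A \<subseteq> (\<Union>i. U i) \<and>
        (\<forall>i. bounded (U i) \<and> diameter (U i) \<le> \<delta>)}.
      (\<Sum>i. if U i = {} then 0
            else ennreal (unit_ball_vol (real k) * (diameter (U i) / 2) ^ k)))"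

text \<open>The size bounds are required for \<open>n \<ge> 1\<close> only, since they exclude a zeroth term
  (one may take \<open>D 0 = {}\<close> if the sequence starts at 1).\<close>

definition regular_sequence :: "(nat \<Rightarrow> (real ^ 'd) set) \<Rightarrow> bool" where
  "regular_sequence D \<longleftrightarrow>
    (\<forall>n. D n \<subseteq> D (Suc n) \<and> compact (D n) \<and> convex (D n)) \<and>
    (\<exists>\<alpha>1>0. \<exists>\<alpha>2>0. \<forall>n\<ge>1.
      \<alpha>1 * real n ^ CARD('d) \<le> measure lebesgue (D n) \<and>
      measure lebesgue (D n) \<le> \<alpha>2 * real n ^ CARD('d) \<and>
      ennreal (\<alpha>1 * real n ^ (CARD('d) - 1)) \<le> hausdorff_measure (CARD('d) - 1) (frontier (D n)) \<and>
      hausdorff_measure (CARD('d) - 1) (frontier (D n)) \<le> ennreal (\<alpha>2 * real n ^ (CARD('d) - 1)))"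


section \<open>Point processes\<close>

text \<open>A realisation of a point process is a locally finite counting measure. Simple point
  processes (random locally finite sets) are those without multiplicities.\<close>

definition counting_measures :: "(real ^ 'd) measure set" where
  "counting_measures =
    {\<mu>. sets \<mu> = sets borel \<and>
        (\<forall>B\<in>sets borel. bounded B \<longrightarrow> (\<exists>k::nat. emeasure \<mu> B = of_nat k))}"

definition configurations :: "(real ^ 'd) measure measure" where
  "configurations = sigma counting_measures
    {{\<mu> \<in> counting_measures. emeasure \<mu> B = of_nat k} | B (k::nat). B \<in> sets borel \<and> bounded B}"

definition point_process :: "'w measure \<Rightarrow> ('w \<Rightarrow> (real ^ 'd) measure) \<Rightarrow> bool" where
  "point_process M X \<longleftrightarrow> X \<in> M \<rightarrow>\<^sub>M configurations"

definition translate :: "real ^ 'd \<Rightarrow> (real ^ 'd) measure \<Rightarrow> (real ^ 'd) measure" where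
  "translate v \<mu> = distr \<mu> borel (\<lambda>x. x + v)"

definition stationary :: "'w measure \<Rightarrow> ('w \<Rightarrow> (real ^ 'd) measure) \<Rightarrow> bool" where
  "stationary M X \<longleftrightarrow>
    (\<forall>v. distr M configurations (\<lambda>\<omega>. translate v (X \<omega>)) = distr M configurations X)"

definition restrict_to :: "(real ^ 'd) set \<Rightarrow> (real ^ 'd) measure \<Rightarrow> (real ^ 'd) measure" where
  "restrict_to D \<mu> = density \<mu> (indicator D)"

text \<open>A family of point process laws, indexed by pairs \<open>(\<theta>, \<eta>)\<close> where \<open>\<theta>\<close> ranges over
  \<open>\<Theta>\<close> and \<open>\<eta>\<close> collects the possible other parameters; the admissible \<open>\<eta>\<close> may depend
  on \<open>\<theta>\<close>.\<close>

definition parametric_family ::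
  "'p set \<Rightarrow> ('p \<times> 'q) set \<Rightarrow> ('p \<times> 'q \<Rightarrow> (real ^ 'd) measure measure) \<Rightarrow> bool" where
  "parametric_family \<Theta> Par P \<longleftrightarrow>
    fst ` Par = \<Theta> \<and> (\<forall>\<xi>\<in>Par. prob_space (P \<xi>) \<and> sets (P \<xi>) = sets configurations)"

text \<open>\<open>J t \<theta>\<close> is a functional of the law of the process that depends on the parameters
  through \<open>\<theta>\<close> only.\<close>

definition summary_statistic ::
  "real set \<Rightarrow> ('p \<times> 'q) set \<Rightarrow> ('p \<times> 'q \<Rightarrow> (real ^ 'd) measure measure) \<Rightarrow>
    (real \<Rightarrow> 'p \<Rightarrow> real) \<Rightarrow> bool" where
  "summary_statistic I Par P J \<longleftrightarrow>
    (\<exists>S. \<forall>t\<in>I. \<forall>(\<theta>, \<eta>)\<in>Par. J t \<theta> = S t (P (\<theta>, \<eta>)))"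

text \<open>An estimator of a function on \<open>I\<close>: each value is a statistic of the points
  observed in \<open>D\<close>, and almost every path is Lebesgue measurable, so that integrals over \<open>I\<close>
  make sense.\<close>

definition functional_estimator ::
  "'w measure \<Rightarrow> ('w \<Rightarrow> (real ^ 'd) measure) \<Rightarrow> (real ^ 'd) set \<Rightarrow> real set \<Rightarrow>
    (real \<Rightarrow> 'w \<Rightarrow> real) \<Rightarrow> bool" where
  "functional_estimator M X D I Jh \<longleftrightarrow>
    (\<forall>t\<in>I. \<exists>T\<in>borel_measurable configurations. \<forall>\<omega>\<in>space M. Jh t \<omega> = T (restrict_to D (X \<omega>))) \<and>
    (AE \<omega> in M. (\<lambda>t. Jh t \<omega>) \<in> borel_measurable (lebesgue_on I))"


section \<open>Minimum contrast estimation\<close>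

text \<open>Real powers \<open>x\<^sup>c\<close>. Negative bases are allowed for integer \<open>c\<close>; the value is only
  meaningful under \<open>rpow_defined\<close>.\<close>

definition rpow_defined :: "real \<Rightarrow> real \<Rightarrow> bool" where
  "rpow_defined x c \<longleftrightarrow> x > 0 \<or> (x = 0 \<and> c > 0) \<or> (x < 0 \<and> c \<in> \<int>)"

definition rpow :: "real \<Rightarrow> real \<Rightarrow> real" where
  "rpow x c = (if x < 0 then x powi \<lfloor>c\<rfloor> else x powr c)"

definition contrast ::
  "real set \<Rightarrow> (real \<Rightarrow> real) \<Rightarrow> real \<Rightarrow> (real \<Rightarrow> real) \<Rightarrow> (real \<Rightarrow> 'p \<Rightarrow> real) \<Rightarrow> 'p \<Rightarrow> real" where
  "contrast I w c j J \<theta> = (LINT t:I|lebesgue. w t * (rpow (j t) c - rpow (J t \<theta>) c)\<^sup>2)"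

text \<open>Convergence in probability to a constant. The outer measure agrees with the
  probability on measurable sets, and makes the notion meaningful for maps that are not known
  to be measurable (suprema over uncountable sets, arbitrary choices of a minimiser).\<close>

definition conv_in_prob :: "'w measure \<Rightarrow> (nat \<Rightarrow> 'w \<Rightarrow> 'a::metric_space) \<Rightarrow> 'a \<Rightarrow> bool" where
  "conv_in_prob M Y y \<longleftrightarrow>
    (\<forall>\<epsilon>>0. (\<lambda>n. outer_measure_of M {\<omega>\<in>space M. dist (Y n \<omega>) y > \<epsilon>}) \<longlonglongrightarrow> 0)"

definition conv_almost_surely ::
    "'w measure \<Rightarrow> (nat \<Rightarrow> 'w \<Rightarrow> 'a::metric_space) \<Rightarrow> 'a \<Rightarrow> bool" where
  "conv_almost_surely M Y y \<longleftrightarrow> (AE \<omega> in M. (\<lambda>n. Y n \<omega>) \<longlonglongrightarrow> y)"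

text \<open>A sequence of argmin estimators for the contrasts \<open>U n \<omega>\<close>, which are meaningful from
  the rank \<open>n0\<close> on. The minimiser need not be unique: any choice is allowed.\<close>

definition argmin_estimator ::
  "'w measure \<Rightarrow> 'p set \<Rightarrow> nat \<Rightarrow> (nat \<Rightarrow> 'w \<Rightarrow> 'p \<Rightarrow> real) \<Rightarrow> (nat \<Rightarrow> 'w \<Rightarrow> 'p) \<Rightarrow> bool" where
  "argmin_estimator M \<Theta> n0 U \<theta>t \<longleftrightarrow>
    (\<forall>n\<ge>n0. AE \<omega> in M. is_arg_min (U n \<omega>) (\<lambda>\<theta>. \<theta> \<in> \<Theta>) (\<theta>t n \<omega>))"

definition argmin_exists_as ::
  "'w measure \<Rightarrow> 'p set \<Rightarrow> nat \<Rightarrow> (nat \<Rightarrow> 'w \<Rightarrow> 'p \<Rightarrow> real) \<Rightarrow> bool" where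
  "argmin_exists_as M \<Theta> n0 U \<longleftrightarrow>
    (\<forall>n\<ge>n0. AE \<omega> in M. \<exists>\<theta>. is_arg_min (U n \<omega>) (\<lambda>\<theta>. \<theta> \<in> \<Theta>) \<theta>)"

text \<open>Uniform consistency on a subset of full measure, for a given mode of convergence \<open>conv\<close>
  (in probability or almost sure). The supremum is a real one: it is to be used for functions
  that are almost surely bounded from some rank on.\<close>

definition uniformly_consistent ::
  "((nat \<Rightarrow> 'w \<Rightarrow> real) \<Rightarrow> real \<Rightarrow> bool) \<Rightarrow> real set \<Rightarrow> (nat \<Rightarrow> real \<Rightarrow> 'w \<Rightarrow> real) \<Rightarrow>
    (real \<Rightarrow> real) \<Rightarrow> bool" where
  "uniformly_consistent conv I Jh j \<longleftrightarrow>
    (\<exists>A\<subseteq>I. I - A \<in> null_sets lebesgue \<and> conv (\<lambda>n \<omega>. SUP t\<in>A. \<bar>Jh n t \<omega> - j t\<bar>) 0)"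

end

theory Submission
  imports Defs
begin

text \<open>Write \<open>U\<close> for the limiting contrast, i.e. the one with \<open>J(t, \<theta>0)\<close> in place of its estimator,
  and \<open>W\<close> for the integral of \<open>w\<close>. From \<open>(a - b)\<^sup>2 \<le> 2 (a - g)\<^sup>2 + 2 (g - b)\<^sup>2\<close> a minimiser \<open>\<theta>\<close> of \<open>U\<^sub>n\<close>
  satisfies \<open>U(\<theta>) \<le> 2 U\<^sub>n(\<theta>0) + 2 U\<^sub>n(\<theta>) \<le> 4 U\<^sub>n(\<theta>0)\<close>, which is at most \<open>4 \<epsilon>\<^sup>2 W\<close> as soon as the
  estimator's \<open>c\<close>-th power is \<open>\<epsilon>\<close>-close to that of \<open>J(t, \<theta>0)\<close>. Since \<open>U\<close> is continuous and vanishes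
  only at \<open>\<theta>0\<close>, compactness of \<open>\<Theta>\<close> bounds it away from \<open>0\<close> off every ball around \<open>\<theta>0\<close>. This
  deterministic implication transfers both modes of convergence.\<close>

section \<open>Real powers on their domain of definition\<close>

text \<open>For integer \<open>c\<close> one integer power describes both signs of the base, and 0
  belongs to the domain only when \<open>c > 0\<close>, so no pole is met. For other
  \<open>c\<close> negative bases are excluded, and \<open>powr\<close> stays continuous at 0
  because \<open>c > 0\<close> there.\<close>

lemma continuous_on_rpow: "continuous_on {x. rpow_defined x c} (\<lambda>x. rpow x c)"
proof (cases "c \<in> \<int>")
  case True
  then obtain k where k: "c = of_int k" by (auto elim: Ints_cases)
  have "rpow x c = x powi k" if "rpow_defined x c" for x
    using that k by (auto simp: rpow_def rpow_defined_def powr_real_of_int' power_int_0_left_if)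
  moreover have "continuous_on {x. rpow_defined x c} (\<lambda>x. x powi k)"
  proof (cases "k > 0")
    case True
    then show ?thesis by (intro continuous_on_power_int continuous_on_id disjI1) simp
  next
    case False
    then have "x \<noteq> 0" if "rpow_defined x c" for x using that by (auto simp: rpow_defined_def k)
    then show ?thesis by (intro continuous_on_power_int continuous_on_id) blast
  qed
  ultimately show ?thesis
    by (subst continuous_on_cong[OF refl]) auto
next
  case False
  have "continuous_on {x. rpow_defined x c} (\<lambda>x. x powr c)"
    using False by (intro continuous_on_powr' continuous_intros) (auto simp: rpow_defined_def)
  moreover have "rpow x c = x powr c" if "rpow_defined x c" for x
    using that False by (auto simp: rpow_def rpow_defined_def)
  ultimately show ?thesis
    by (subst continuous_on_cong[OF refl]) auto
qed

lemma borel_measurable_rpow [measurable]: "(\<lambda>x. rpow x c) \<in> borel_measurable borel"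
  unfolding rpow_def power_int_def by measurable

text \<open>Raising to the power \<open>1 / c\<close> inverts the map. Positive bases matter: an
  even integer exponent identifies \<open>x\<close> and \<open>-x\<close>. This is how positivity of
  \<open>J\<close> enters identifiability.\<close>

lemma rpow_pos_inj:
  assumes "x > 0" "y > 0" "c \<noteq> 0" "rpow x c = rpow y c"
  shows "x = y"
proof -
  have "x powr c = y powr c" using assms by (simp add: rpow_def)
  then have "(x powr c) powr (1 / c) = (y powr c) powr (1 / c)" by simp
  then show ?thesis using assms by (simp add: powr_powr)
qed

text \<open>Only \<open>x\<close> is confined to a compact set; \<open>y\<close> ranges over all of
  \<open>T\<close>, as estimated values need not lie in the range of the true statistic. If the
  claim failed, violating pairs at distances tending to 0 would, along a subsequence, both converge
  to a point of \<open>S\<close>, where continuity of \<open>f\<close> brings their images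
  together.\<close>

lemma continuous_on_uniform_near_compact:
  fixes f :: "'a::metric_space \<Rightarrow> 'b::metric_space"
  assumes "compact S" "S \<subseteq> T" "continuous_on T f" "\<epsilon> > 0"
  shows "\<exists>\<delta>>0. \<forall>x\<in>S. \<forall>y\<in>T. dist y x \<le> \<delta> \<longrightarrow> dist (f y) (f x) \<le> \<epsilon>"
proof (rule ccontr)
  assume "\<not> ?thesis"
  then have neg: "\<exists>x y. x \<in> S \<and> y \<in> T \<and> dist y x \<le> \<delta> \<and> \<not> dist (f y) (f x) \<le> \<epsilon>" if "\<delta> > 0" for \<delta>
    using that by blast
  have "\<forall>n. \<exists>x y. x \<in> S \<and> y \<in> T \<and> dist y x \<le> inverse (real (Suc n)) \<and> \<not> dist (f y) (f x) \<le> \<epsilon>"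
    by (intro allI neg) simp
  then obtain x y where xy: "\<And>n. x n \<in> S" "\<And>n. y n \<in> T"
    "\<And>n. dist (y n) (x n) \<le> inverse (real (Suc n))" "\<And>n. \<not> dist (f (y n)) (f (x n)) \<le> \<epsilon>"
    by metis
  obtain l r where l: "l \<in> S" "strict_mono r" "(x \<circ> r) \<longlonglongrightarrow> l"
    using \<open>compact S\<close> xy(1) unfolding compact_def by metis
  have "(\<lambda>n. dist (y n) (x n)) \<longlonglongrightarrow> 0"
    by (rule tendsto_sandwich[OF _ _ tendsto_const LIMSEQ_inverse_real_of_nat]) (use xy(3) in auto)
  then have "(\<lambda>n. dist (y (r n)) (x (r n))) \<longlonglongrightarrow> 0"
    using l(2) LIMSEQ_subseq_LIMSEQ by (fastforce simp: o_def)
  moreover have "(\<lambda>n. dist (x (r n)) l) \<longlonglongrightarrow> 0"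
    using l(3) by (simp add: tendsto_dist_iff[of _ l] o_def)
  ultimately have "(\<lambda>n. dist (y (r n)) (x (r n)) + dist (x (r n)) l) \<longlonglongrightarrow> 0"
    by (rule tendsto_add_zero)
  then have y: "(\<lambda>n. y (r n)) \<longlonglongrightarrow> l"
    unfolding tendsto_dist_iff[of _ l]
    by (rule Lim_null_comparison[rotated]) (auto intro!: always_eventually dist_triangle)
  have "(\<lambda>n. f (y (r n))) \<longlonglongrightarrow> f l" "(\<lambda>n. f (x (r n))) \<longlonglongrightarrow> f l"
    using assms(2) xy(1,2) l y unfolding o_def
    by (auto intro!: continuous_on_tendsto_compose[OF assms(3)] always_eventually)
  then have "(\<lambda>n. dist (f (y (r n))) (f (x (r n)))) \<longlonglongrightarrow> 0"
    using tendsto_dist by fastforce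
  then have "\<forall>\<^sub>F n in sequentially. dist (f (y (r n))) (f (x (r n))) < \<epsilon>"
    using \<open>\<epsilon> > 0\<close> by (rule order_tendstoD)
  then show False
    using xy(4) by (auto simp: eventually_sequentially not_le intro: less_asym)
qed

section \<open>Weighted quadratic contrasts over a compact parameter set\<close>

text \<open>\<open>K\<close> stands for the \<open>c\<close>-th power of \<open>J\<close>. Once the
  power is absorbed, the contrast \<open>Q g \<theta>\<close> is the squared distance from
  \<open>g\<close> to \<open>K(., \<theta>)\<close> in the L2 space with weight
  \<open>w\<close>.\<close>

locale weighted_contrast =
  fixes I :: "real set" and w :: "real \<Rightarrow> real" and \<Theta> :: "'p::metric_space set"
    and K :: "real \<Rightarrow> 'p \<Rightarrow> real"
  assumes compact_I: "compact I" and compact_\<Theta>: "compact \<Theta>"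
    and w_pos: "\<And>t. t \<in> I \<Longrightarrow> w t > 0" and w_integrable: "integrable (lebesgue_on I) w"
    and K_continuous: "continuous_on (I \<times> \<Theta>) (\<lambda>(t, \<theta>). K t \<theta>)"
begin

definition Q :: "(real \<Rightarrow> real) \<Rightarrow> 'p \<Rightarrow> real" where
  "Q g \<theta> = (LINT t|lebesgue_on I. w t * (g t - K t \<theta>)\<^sup>2)"

definition admissible :: "(real \<Rightarrow> real) \<Rightarrow> bool" where
  "admissible g \<longleftrightarrow> g \<in> borel_measurable (lebesgue_on I) \<and> bounded (g ` I)"

lemma I_lebesgue: "I \<in> sets lebesgue"
  using compact_I by (simp add: borel_compact)

lemma K_continuous_snd: "t \<in> I \<Longrightarrow> continuous_on \<Theta> (K t)"
  using continuous_on_compose2[OF K_continuous, of \<Theta> "\<lambda>\<theta>. (t, \<theta>)"]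
  by (force intro: continuous_on_Pair continuous_on_const continuous_on_id)

lemma K_bound:
  obtains C where "C > 0" "\<And>t \<theta>. t \<in> I \<Longrightarrow> \<theta> \<in> \<Theta> \<Longrightarrow> \<bar>K t \<theta>\<bar> \<le> C"
proof -
  have "bounded ((\<lambda>(t, \<theta>). K t \<theta>) ` (I \<times> \<Theta>))"
    by (intro compact_imp_bounded compact_continuous_image K_continuous compact_Times compact_I compact_\<Theta>)
  then show ?thesis using that unfolding bounded_pos by force
qed

text \<open>This makes the limiting contrast, with \<open>g = K(., \<theta>0)\<close>, an instance
  of \<open>Q\<close> to which the facts on admissible functions apply.\<close>

lemma admissible_K: "\<theta> \<in> \<Theta> \<Longrightarrow> admissible (\<lambda>t. K t \<theta>)"
proof -
  assume \<theta>: "\<theta> \<in> \<Theta>"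
  have "continuous_on I (\<lambda>t. K t \<theta>)"
    using continuous_on_compose2[OF K_continuous, of I "\<lambda>t. (t, \<theta>)"] \<theta>
    by (force intro: continuous_on_Pair continuous_on_const continuous_on_id)
  then show ?thesis
    unfolding admissible_def using compact_I I_lebesgue
    by (auto intro!: continuous_imp_measurable_on_sets_lebesgue compact_imp_bounded compact_continuous_image)
qed

text \<open>The constant \<open>B\<close> is the same for all parameters, so \<open>B * w\<close>
  serves both for integrability and as dominating function when the parameter varies.\<close>

lemma integrand_bound:
  assumes "admissible g"
  obtains B where "\<And>t \<theta>. t \<in> I \<Longrightarrow> \<theta> \<in> \<Theta> \<Longrightarrow> norm (w t * (g t - K t \<theta>)\<^sup>2) \<le> B * w t"
proof -
  obtain C where C: "\<And>t \<theta>. t \<in> I \<Longrightarrow> \<theta> \<in> \<Theta> \<Longrightarrow> \<bar>K t \<theta>\<bar> \<le> C" using K_bound by metis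
  obtain G where G: "\<And>t. t \<in> I \<Longrightarrow> \<bar>g t\<bar> \<le> G"
    using assms unfolding admissible_def bounded_iff by auto
  have "norm (w t * (g t - K t \<theta>)\<^sup>2) \<le> (G + C)\<^sup>2 * w t" if t: "t \<in> I" "\<theta> \<in> \<Theta>" for t \<theta>
  proof -
    have "\<bar>g t - K t \<theta>\<bar> \<le> G + C" using G[OF t(1)] C[OF t] by linarith
    then have "(g t - K t \<theta>)\<^sup>2 \<le> (G + C)\<^sup>2" by (metis abs_ge_zero power2_abs power_mono)
    then show ?thesis using w_pos[OF t(1)] by (simp add: abs_mult)
  qed
  then show ?thesis using that by blast
qed

lemma integrand_measurable:
  assumes "admissible g" "\<theta> \<in> \<Theta>"
  shows "(\<lambda>t. w t * (g t - K t \<theta>)\<^sup>2) \<in> borel_measurable (lebesgue_on I)"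
proof -
  have [measurable]: "g \<in> borel_measurable (lebesgue_on I)" "w \<in> borel_measurable (lebesgue_on I)"
    "(\<lambda>t. K t \<theta>) \<in> borel_measurable (lebesgue_on I)"
    using assms admissible_K w_integrable unfolding admissible_def by auto
  show ?thesis by measurable
qed

lemma integrand_integrable:
  assumes "admissible g" "\<theta> \<in> \<Theta>"
  shows "integrable (lebesgue_on I) (\<lambda>t. w t * (g t - K t \<theta>)\<^sup>2)"
proof -
  obtain B where B: "\<And>t. t \<in> I \<Longrightarrow> norm (w t * (g t - K t \<theta>)\<^sup>2) \<le> B * w t"
    using integrand_bound[OF assms(1)] assms(2) by metis
  show ?thesis
    by (rule Bochner_Integration.integrable_bound[OF _ integrand_measurable[OF assms], of "\<lambda>t. B * w t"])
      (use B w_integrable in \<open>auto intro!: AE_I2 order_trans[OF _ abs_ge_self]\<close>)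
qed

text \<open>Dominated convergence along sequences of parameters: for each fixed \<open>t\<close> the
  integrand converges by continuity of \<open>K t\<close>.\<close>

lemma continuous_on_Q:
  assumes "admissible g"
  shows "continuous_on \<Theta> (Q g)"
  unfolding continuous_on_sequentially o_def
proof (intro allI ballI impI, elim conjE)
  fix x \<theta> assume x: "\<forall>n. x n \<in> \<Theta>" "x \<longlonglongrightarrow> \<theta>" and \<theta>: "\<theta> \<in> \<Theta>"
  obtain B where B: "\<And>t \<theta>. t \<in> I \<Longrightarrow> \<theta> \<in> \<Theta> \<Longrightarrow> norm (w t * (g t - K t \<theta>)\<^sup>2) \<le> B * w t"
    using integrand_bound[OF assms] by metis
  show "(\<lambda>n. Q g (x n)) \<longlonglongrightarrow> Q g \<theta>"
    unfolding Q_def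
  proof (rule integral_dominated_convergence[where w = "\<lambda>t. B * w t"])
    show "AE t in lebesgue_on I. (\<lambda>n. w t * (g t - K t (x n))\<^sup>2) \<longlonglongrightarrow> w t * (g t - K t \<theta>)\<^sup>2"
    proof (rule AE_I2)
      fix t assume "t \<in> space (lebesgue_on I)"
      then have "(\<lambda>n. K t (x n)) \<longlonglongrightarrow> K t \<theta>"
        using continuous_on_tendsto_compose[OF K_continuous_snd x(2) \<theta>] x(1) by auto
      then show "(\<lambda>n. w t * (g t - K t (x n))\<^sup>2) \<longlonglongrightarrow> w t * (g t - K t \<theta>)\<^sup>2"
        by (intro tendsto_intros)
    qed
  qed (use assms x(1) \<theta> B w_integrable in \<open>auto intro!: integrand_measurable AE_I2\<close>)
qed

lemma argmin_exists:
  assumes "admissible g" "\<Theta> \<noteq> {}"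
  shows "\<exists>\<theta>. is_arg_min (Q g) (\<lambda>\<theta>. \<theta> \<in> \<Theta>) \<theta>"
  using continuous_attains_inf[OF compact_\<Theta> assms(2) continuous_on_Q[OF assms(1)]]
  by (auto simp: is_arg_min_linorder)

text \<open>A nonnegative integrand with zero integral vanishes almost everywhere, and positivity of
  \<open>w\<close> allows the weight to be cancelled.\<close>

lemma Q_pos:
  assumes "admissible g" "\<theta> \<in> \<Theta>" "\<not> (AE t in lebesgue_on I. K t \<theta> = g t)"
  shows "Q g \<theta> > 0"
proof -
  have nonneg: "AE t in lebesgue_on I. 0 \<le> w t * (g t - K t \<theta>)\<^sup>2"
    using w_pos by (intro AE_I2 mult_nonneg_nonneg zero_le_power2) (auto intro: less_imp_le)
  have "Q g \<theta> \<noteq> 0"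
  proof
    assume "Q g \<theta> = 0"
    then have "AE t in lebesgue_on I. w t * (g t - K t \<theta>)\<^sup>2 = 0"
      using integral_nonneg_eq_0_iff_AE[OF integrand_integrable[OF assms(1,2)] nonneg]
      by (simp add: Q_def)
    then have "AE t in lebesgue_on I. K t \<theta> = g t"
      using AE_space
      by eventually_elim (use w_pos in force)
    then show False using assms(3) by simp
  qed
  moreover have "Q g \<theta> \<ge> 0"
    unfolding Q_def by (rule integral_nonneg_AE[OF nonneg])
  ultimately show ?thesis by simp
qed

lemma Q_le_argmin:
  assumes "admissible g" "\<theta>0 \<in> \<Theta>" "is_arg_min (Q g) (\<lambda>\<theta>. \<theta> \<in> \<Theta>) \<theta>"
  shows "Q (\<lambda>t. K t \<theta>0) \<theta> \<le> 4 * Q g \<theta>0"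
proof -
  have \<theta>: "\<theta> \<in> \<Theta>" "Q g \<theta> \<le> Q g \<theta>0"
    using assms(2,3) by (auto simp: is_arg_min_linorder)
  have "Q (\<lambda>t. K t \<theta>0) \<theta> \<le>
      (LINT t|lebesgue_on I. 2 * (w t * (g t - K t \<theta>0)\<^sup>2) + 2 * (w t * (g t - K t \<theta>)\<^sup>2))"
    unfolding Q_def
  proof (rule integral_mono)
    fix t assume "t \<in> space (lebesgue_on I)"
    then have "w t > 0" using w_pos by simp
    moreover have "(K t \<theta>0 - K t \<theta>)\<^sup>2 \<le> 2 * (g t - K t \<theta>0)\<^sup>2 + 2 * (g t - K t \<theta>)\<^sup>2"
      \<comment> \<open>Parallelogram identity: the right-hand side exceeds the left by exactly this
        square.\<close>
      using zero_le_power2[of "2 * g t - K t \<theta>0 - K t \<theta>"]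
      by (simp add: power2_eq_square algebra_simps)
    ultimately have "w t * (K t \<theta>0 - K t \<theta>)\<^sup>2 \<le> w t * (2 * (g t - K t \<theta>0)\<^sup>2 + 2 * (g t - K t \<theta>)\<^sup>2)"
      by simp
    then show "w t * (K t \<theta>0 - K t \<theta>)\<^sup>2 \<le> 2 * (w t * (g t - K t \<theta>0)\<^sup>2) + 2 * (w t * (g t - K t \<theta>)\<^sup>2)"
      by (simp add: algebra_simps)
  qed (use assms \<theta> integrand_integrable admissible_K in auto)
  also have "\<dots> = 2 * Q g \<theta>0 + 2 * Q g \<theta>"
    unfolding Q_def using integrand_integrable assms \<theta> by simp
  finally show ?thesis using \<theta>(2) by simp
qed

lemma Q_le_uniform:
  assumes "admissible g" "\<theta> \<in> \<Theta>" "AE t in lebesgue_on I. \<bar>g t - K t \<theta>\<bar> \<le> \<epsilon>"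
  shows "Q g \<theta> \<le> \<epsilon>\<^sup>2 * (LINT t|lebesgue_on I. w t)"
proof -
  have "Q g \<theta> \<le> (LINT t|lebesgue_on I. \<epsilon>\<^sup>2 * w t)"
    unfolding Q_def
  proof (rule integral_mono_AE)
    show "AE t in lebesgue_on I. w t * (g t - K t \<theta>)\<^sup>2 \<le> \<epsilon>\<^sup>2 * w t"
      using assms(3) AE_space
    proof eventually_elim
      case (elim t)
      then have "(g t - K t \<theta>)\<^sup>2 \<le> \<epsilon>\<^sup>2" by (metis abs_ge_zero power2_abs power_mono)
      then show ?case using elim w_pos[of t] by simp
    qed
  qed (use assms integrand_integrable w_integrable in auto)
  then show ?thesis by simp
qed

text \<open>The tolerance \<open>\<epsilon>\<close> is uniform in \<open>g\<close> and in the chosen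
  minimiser, so it can be fixed before the sample size and the realisation.\<close>

lemma argmin_near:
  assumes \<theta>0: "\<theta>0 \<in> \<Theta>"
    and identifiable: "\<And>\<theta>. \<theta> \<in> \<Theta> \<Longrightarrow> \<theta> \<noteq> \<theta>0 \<Longrightarrow> \<not> (AE t in lebesgue_on I. K t \<theta> = K t \<theta>0)"
    and "\<eta> > 0"
  shows "\<exists>\<epsilon>>0. \<forall>g \<theta>. admissible g \<longrightarrow> (AE t in lebesgue_on I. \<bar>g t - K t \<theta>0\<bar> \<le> \<epsilon>) \<longrightarrow>
    is_arg_min (Q g) (\<lambda>\<theta>. \<theta> \<in> \<Theta>) \<theta> \<longrightarrow> dist \<theta> \<theta>0 < \<eta>"
proof -
  define Q0 where "Q0 = Q (\<lambda>t. K t \<theta>0)"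
  define W where "W = (LINT t|lebesgue_on I. w t)"
  let ?F = "\<Theta> - ball \<theta>0 \<eta>"
  have W: "W \<ge> 0"
    unfolding W_def using w_pos by (intro integral_nonneg_AE AE_I2) (auto intro: less_imp_le)
  obtain m where m: "m > 0" "\<And>\<theta>. \<theta> \<in> ?F \<Longrightarrow> m \<le> Q0 \<theta>"
  proof (cases "?F = {}")
    case True
    \<comment> \<open>No parameter lies outside the ball, so the lower bound is vacuous and any
      positive \<open>m\<close> will do.\<close>
    then show ?thesis by (intro that[of 1]) auto
  next
    case False
    have "compact ?F" using compact_\<Theta> by (simp add: compact_diff)
    moreover have "continuous_on ?F Q0"
      unfolding Q0_def using continuous_on_Q[OF admissible_K[OF \<theta>0]] by (rule continuous_on_subset) auto
    ultimately obtain \<theta> where \<theta>: "\<theta> \<in> ?F" "\<And>\<theta>'. \<theta>' \<in> ?F \<Longrightarrow> Q0 \<theta> \<le> Q0 \<theta>'"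
      using continuous_attains_inf[OF _ False, of Q0] by blast
    then have "Q0 \<theta> > 0"
      unfolding Q0_def using \<open>\<eta> > 0\<close> by (intro Q_pos admissible_K \<theta>0 identifiable) auto
    then show ?thesis using that \<theta>(2) by blast
  qed
  \<comment> \<open>Chosen so that \<open>4 * (\<epsilon>\<^sup>2 * W) = m * W / (W + 1)\<close>.
    The added 1 makes this strictly smaller than \<open>m\<close> and keeps the denominator positive
    even if \<open>W = 0\<close>.\<close>
  define \<epsilon> where "\<epsilon> = sqrt (m / (4 * (W + 1)))"
  have "\<epsilon> > 0" unfolding \<epsilon>_def using m(1) W by simp
  have \<epsilon>2: "4 * (\<epsilon>\<^sup>2 * W) < m"
    unfolding \<epsilon>_def using m(1) W by (simp add: field_simps)
  have "dist \<theta> \<theta>0 < \<eta>"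
    if g: "admissible g" "AE t in lebesgue_on I. \<bar>g t - K t \<theta>0\<bar> \<le> \<epsilon>"
      "is_arg_min (Q g) (\<lambda>\<theta>. \<theta> \<in> \<Theta>) \<theta>" for g \<theta>
  proof (rule ccontr)
    assume "\<not> dist \<theta> \<theta>0 < \<eta>"
    then have "\<theta> \<in> ?F" using g(3) by (auto simp: is_arg_min_def dist_commute)
    then have "m \<le> 4 * Q g \<theta>0"
      using m(2) Q_le_argmin[OF g(1) \<theta>0 g(3)] unfolding Q0_def by fastforce
    then show False
      using Q_le_uniform[OF g(1) \<theta>0 g(2)] \<epsilon>2 unfolding W_def by linarith
  qed
  then show ?thesis using \<open>\<epsilon> > 0\<close> by blast
qed

end

section \<open>Outer measure and null sets\<close>

text \<open>Neither set need be measurable: a measurable cover of \<open>B\<close> becomes one of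
  \<open>A\<close> after adding a null set, which leaves its measure unchanged.\<close>

lemma outer_measure_of_le_AE:
  assumes "AE \<omega> in M. \<omega> \<in> A \<longrightarrow> \<omega> \<in> B" "A \<subseteq> space M" "B \<subseteq> space M"
  shows "outer_measure_of M A \<le> outer_measure_of M B"
proof -
  obtain N where N: "N \<in> null_sets M" "{\<omega> \<in> space M. \<not> (\<omega> \<in> A \<longrightarrow> \<omega> \<in> B)} \<subseteq> N"
    using assms(1) by (auto elim!: AE_E simp: null_sets_def)
  show ?thesis
    unfolding outer_measure_of_def[of M B]
  proof (rule INF_greatest)
    fix C assume C: "C \<in> {C \<in> sets M. B \<subseteq> C}"
    then have "A \<subseteq> C \<union> N" using N(2) assms(2) by auto
    then have "outer_measure_of M A \<le> emeasure M (C \<union> N)"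
      unfolding outer_measure_of_def using C N(1) by (intro INF_lower) auto
    also have "\<dots> = emeasure M C" using C N(1) by (intro emeasure_Un_null_set) auto
    finally show "outer_measure_of M A \<le> emeasure M C" .
  qed
qed

section \<open>Existence and consistency of the minimum contrast estimator\<close>

theorem theorem5p1:
  fixes M :: "'w measure"
    and X :: "'w \<Rightarrow> (real ^ 'd) measure"
    and \<Theta> :: "(real ^ 'p) set"
    and Par :: "((real ^ 'p) \<times> 'q) set"
    and P :: "(real ^ 'p) \<times> 'q \<Rightarrow> (real ^ 'd) measure measure"
    and \<theta>0 :: "real ^ 'p"
    and \<eta>0 :: 'q
    and rmin rmax c :: real
    and D :: "nat \<Rightarrow> (real ^ 'd) set"
    and J :: "real \<Rightarrow> real ^ 'p \<Rightarrow> real"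
    and Jh :: "nat \<Rightarrow> real \<Rightarrow> 'w \<Rightarrow> real"
    and w :: "real \<Rightarrow> real"
    and n0 :: nat
  defines "U \<equiv> \<lambda>n \<omega>. contrast {rmin..rmax} w c (\<lambda>t. Jh n t \<omega>) J"
  assumes "prob_space M"
    and "point_process M X"
    and "stationary M X"
    and "parametric_family \<Theta> Par P"
    and "(\<theta>0, \<eta>0) \<in> Par" and "distr M configurations X = P (\<theta>0, \<eta>0)"
    and "\<theta>0 \<in> interior \<Theta>"
    and "summary_statistic {rmin..rmax} Par P J"
    and "\<And>n. functional_estimator M X (D n) {rmin..rmax} (Jh n)"
    and A1: "compact \<Theta>" "interior \<Theta> \<noteq> {}" "0 \<le> rmin" "rmin < rmax" "c \<noteq> 0" "regular_sequence D"
    and A2: "\<And>t. t \<in> {rmin..rmax} \<Longrightarrow> w t > 0" "set_integrable lebesgue {rmin..rmax} w"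
    and A3: "\<And>t \<theta>. t \<in> {rmin..rmax} \<Longrightarrow> \<theta> \<in> \<Theta> \<Longrightarrow> rpow_defined (J t \<theta>) c"
      "continuous_on ({rmin..rmax} \<times> \<Theta>) (\<lambda>(t, \<theta>). J t \<theta>)"
      "continuous_on ({rmin..rmax} \<times> \<Theta>) (\<lambda>(t, \<theta>). rpow (J t \<theta>) c)"
      "\<exists>A\<subseteq>{rmin..rmax}. {rmin..rmax} - A \<in> null_sets lebesgue \<and> (\<forall>t\<in>A. \<forall>\<theta>\<in>\<Theta>. J t \<theta> > 0)"
    and A4: "\<And>n. n \<ge> n0 \<Longrightarrow> AE \<omega> in M.
        (\<forall>t\<in>{rmin..rmax}. rpow_defined (Jh n t \<omega>) c) \<and>
        bounded ((\<lambda>t. Jh n t \<omega>) ` {rmin..rmax}) \<and>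
        bounded ((\<lambda>t. rpow (Jh n t \<omega>) c) ` {rmin..rmax})"
    and A6: "\<And>\<theta>1 \<theta>2. \<theta>1 \<in> \<Theta> \<Longrightarrow> \<theta>2 \<in> \<Theta> \<Longrightarrow> \<theta>1 \<noteq> \<theta>2 \<Longrightarrow>
        \<exists>A\<in>sets lebesgue. A \<subseteq> {rmin..rmax} \<and> emeasure lebesgue A > 0 \<and> (\<forall>t\<in>A. J t \<theta>1 \<noteq> J t \<theta>2)"
  shows "(uniformly_consistent (conv_in_prob M) {rmin..rmax} Jh (\<lambda>t. J t \<theta>0) \<longrightarrow>
          argmin_exists_as M \<Theta> n0 U \<and>
          (\<forall>\<theta>t. argmin_estimator M \<Theta> n0 U \<theta>t \<longrightarrow> conv_in_prob M \<theta>t \<theta>0)) \<and>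
        (uniformly_consistent (conv_almost_surely M) {rmin..rmax} Jh (\<lambda>t. J t \<theta>0) \<longrightarrow>
          argmin_exists_as M \<Theta> n0 U \<and>
          (\<forall>\<theta>t. argmin_estimator M \<Theta> n0 U \<theta>t \<longrightarrow> conv_almost_surely M \<theta>t \<theta>0))"
proof -
  define I where "I = {rmin..rmax}"
  define K where "K = (\<lambda>t \<theta>. rpow (J t \<theta>) c)"
  \<comment> \<open>The almost sure properties of an estimator's path, stated for a deterministic
    function so that the main estimate below involves no randomness.\<close>
  define good where "good j \<longleftrightarrow> j \<in> borel_measurable (lebesgue_on I) \<and>
    (\<forall>t\<in>I. rpow_defined (j t) c) \<and> bounded (j ` I) \<and> bounded ((\<lambda>t. rpow (j t) c) ` I)" for j
  have \<theta>0: "\<theta>0 \<in> \<Theta>" using \<open>\<theta>0 \<in> interior \<Theta>\<close> interior_subset by blast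
  have I: "I \<in> sets lebesgue" unfolding I_def by simp
  interpret weighted_contrast I w \<Theta> K
  proof
    show "integrable (lebesgue_on I) w"
      using A2(2) I unfolding I_def by (simp add: set_integrable_def integrable_restrict_space)
  qed (use A1 A2 A3 in \<open>auto simp: I_def K_def\<close>)
  have contrast_eq: "contrast I w c j J = Q (\<lambda>t. rpow (j t) c)" for j
    unfolding contrast_def Q_def fun_eq_iff set_lebesgue_integral_def
    using I by (simp add: integral_restrict_space K_def)
  have admissible: "admissible (\<lambda>t. rpow (j t) c)" if "good j" for j
    using that unfolding good_def admissible_def by (auto intro: measurable_compose[OF _ borel_measurable_rpow])
  have J0_continuous: "continuous_on I (\<lambda>t. J t \<theta>0)"
    using continuous_on_compose2[OF A3(2), of I "\<lambda>t. (t, \<theta>0)"] \<theta>0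
    by (force simp: I_def intro: continuous_on_Pair continuous_on_const continuous_on_id)
  then have J0_compact: "compact ((\<lambda>t. J t \<theta>0) ` I)"
    using compact_I by (rule compact_continuous_image)

  \<comment> \<open>Off a null set all values of \<open>J\<close> are positive, so equal powers give
    equal values; almost everywhere equality of the powers would make the separating set
    \<open>A\<close> null.\<close>
  have identifiable: "\<not> (AE t in lebesgue_on I. K t \<theta> = K t \<theta>0)" if \<theta>: "\<theta> \<in> \<Theta>" "\<theta> \<noteq> \<theta>0" for \<theta>
  proof
    assume "AE t in lebesgue_on I. K t \<theta> = K t \<theta>0"
    then have K: "AE t in lebesgue. t \<in> I \<longrightarrow> K t \<theta> = K t \<theta>0"
      using I by (simp add: AE_restrict_space_iff)
    obtain A where A: "A \<in> sets lebesgue" "A \<subseteq> I" "emeasure lebesgue A > 0" "\<And>t. t \<in> A \<Longrightarrow> J t \<theta> \<noteq> J t \<theta>0"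
      using A6[OF \<theta>(1) \<theta>0 \<theta>(2)] unfolding I_def by blast
    obtain A' where A': "I - A' \<in> null_sets lebesgue" "\<And>t \<theta>. t \<in> A' \<Longrightarrow> \<theta> \<in> \<Theta> \<Longrightarrow> J t \<theta> > 0"
      using A3(4) unfolding I_def by blast
    have "AE t in lebesgue. t \<notin> A"
      using K AE_not_in[OF A'(1)]
    proof eventually_elim
      case (elim t)
      show ?case
      proof
        assume t: "t \<in> A"
        then have "t \<in> A'" "K t \<theta> = K t \<theta>0" using elim A(2) by auto
        then have "J t \<theta> = J t \<theta>0"
          using A'(2) \<theta>(1) \<theta>0 A1(5) unfolding K_def by (blast intro: rpow_pos_inj)
        then show False using A(4) t by blast
      qed
    qed
    then have "A \<in> null_sets lebesgue" using A(1) by (simp add: AE_iff_null_sets)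
    then show False using A(3) by auto
  qed

  \<comment> \<open>\<open>\<delta>\<close> depends on \<open>\<eta>\<close> alone among the
    quantities that vary here, not on \<open>A\<close>, \<open>j\<close> or the minimiser. Both
    modes of convergence rest on this.\<close>
  have key: "\<exists>\<delta>>0. \<forall>A j \<theta>. A \<subseteq> I \<longrightarrow> I - A \<in> null_sets lebesgue \<longrightarrow> good j \<longrightarrow>
      is_arg_min (contrast I w c j J) (\<lambda>\<theta>. \<theta> \<in> \<Theta>) \<theta> \<longrightarrow>
      dist (SUP t\<in>A. \<bar>j t - J t \<theta>0\<bar>) 0 \<le> \<delta> \<longrightarrow> dist \<theta> \<theta>0 < \<eta>" if "\<eta> > 0" for \<eta>
  proof -
    obtain \<epsilon> where \<epsilon>: "\<epsilon> > 0"
      "\<And>g \<theta>. admissible g \<Longrightarrow> AE t in lebesgue_on I. \<bar>g t - K t \<theta>0\<bar> \<le> \<epsilon> \<Longrightarrow>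
        is_arg_min (Q g) (\<lambda>\<theta>. \<theta> \<in> \<Theta>) \<theta> \<Longrightarrow> dist \<theta> \<theta>0 < \<eta>"
      using argmin_near[OF \<theta>0 identifiable \<open>\<eta> > 0\<close>] by blast
    \<comment> \<open>The power map need not be uniformly continuous on its whole domain (for
      instance near 0 when \<open>c < 0\<close>), but it is so near the compact range of
      \<open>J(., \<theta>0)\<close>.\<close>
    have "(\<lambda>t. J t \<theta>0) ` I \<subseteq> {x. rpow_defined x c}"
      using A3(1) \<theta>0 unfolding I_def by auto
    from continuous_on_uniform_near_compact[OF J0_compact this continuous_on_rpow \<epsilon>(1)]
    obtain \<delta> where "\<delta> > 0" and \<delta>: "\<forall>x\<in>(\<lambda>t. J t \<theta>0) ` I. \<forall>y\<in>{x. rpow_defined x c}.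
        dist y x \<le> \<delta> \<longrightarrow> dist (rpow y c) (rpow x c) \<le> \<epsilon>"
      by (elim exE conjE)
    have "dist \<theta> \<theta>0 < \<eta>"
      if A: "A \<subseteq> I" "I - A \<in> null_sets lebesgue" and j: "good j"
        and \<theta>: "is_arg_min (contrast I w c j J) (\<lambda>\<theta>. \<theta> \<in> \<Theta>) \<theta>"
        and sup: "dist (SUP t\<in>A. \<bar>j t - J t \<theta>0\<bar>) 0 \<le> \<delta>" for A j \<theta>
    proof (rule \<epsilon>(2)[OF admissible[OF j]])
      \<comment> \<open>A real \<open>SUP\<close> is known to dominate its terms only when they are
        bounded above, so boundedness of both functions comes first.\<close>
      have "bounded ((\<lambda>t. J t \<theta>0) ` I)" "bounded (j ` I)"
        using j J0_compact unfolding good_def by (auto intro: compact_imp_bounded)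
      then obtain a b where "\<And>t. t \<in> I \<Longrightarrow> \<bar>J t \<theta>0\<bar> \<le> a" "\<And>t. t \<in> I \<Longrightarrow> \<bar>j t\<bar> \<le> b"
        unfolding bounded_iff by auto
      then have "\<bar>j t - J t \<theta>0\<bar> \<le> a + b" if "t \<in> I" for t
        using that by (smt (verit))
      then have bdd: "bdd_above ((\<lambda>t. \<bar>j t - J t \<theta>0\<bar>) ` A)"
        using A(1) by (intro bdd_aboveI2[of _ _ "a + b"]) auto
      have A_le: "\<bar>rpow (j t) c - K t \<theta>0\<bar> \<le> \<epsilon>" if t: "t \<in> A" for t
      proof -
        have "\<bar>j t - J t \<theta>0\<bar> \<le> (SUP t\<in>A. \<bar>j t - J t \<theta>0\<bar>)" by (rule cSUP_upper[OF t bdd])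
        then have "\<bar>j t - J t \<theta>0\<bar> \<le> \<delta>" using sup by (simp add: dist_real_def)
        then show ?thesis
          unfolding K_def using \<delta> t A(1) j by (auto simp: good_def dist_real_def)
      qed
      show "AE t in lebesgue_on I. \<bar>rpow (j t) c - K t \<theta>0\<bar> \<le> \<epsilon>"
        using I A_le AE_not_in[OF A(2)] by (auto simp: AE_restrict_space_iff)
      show "is_arg_min (Q (\<lambda>t. rpow (j t) c)) (\<lambda>\<theta>. \<theta> \<in> \<Theta>) \<theta>" using \<theta> by (simp add: contrast_eq)
    qed
    then show ?thesis using \<open>\<delta> > 0\<close> by blast
  qed

  have good: "AE \<omega> in M. good (\<lambda>t. Jh n t \<omega>)" if "n \<ge> n0" for n
  proof -
    have "AE \<omega> in M. (\<lambda>t. Jh n t \<omega>) \<in> borel_measurable (lebesgue_on I)"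
      using assms(10)[of n] unfolding functional_estimator_def I_def by blast
    then show ?thesis
      using A4[OF that] unfolding good_def I_def by eventually_elim blast
  qed
  have ex: "argmin_exists_as M \<Theta> n0 U"
    unfolding argmin_exists_as_def U_def I_def[symmetric] contrast_eq
  proof (intro allI impI)
    fix n assume "n \<ge> n0"
    show "AE \<omega> in M. \<exists>\<theta>. is_arg_min (Q (\<lambda>t. rpow (Jh n t \<omega>) c)) (\<lambda>\<theta>. \<theta> \<in> \<Theta>) \<theta>"
      using good[OF \<open>n \<ge> n0\<close>] by eventually_elim (use \<theta>0 in \<open>auto intro!: argmin_exists admissible\<close>)
  qed

  \<comment> \<open>Consistency in probability\<close>
  have "conv_in_prob M \<theta>t \<theta>0"
    if uc: "uniformly_consistent (conv_in_prob M) I Jh (\<lambda>t. J t \<theta>0)"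
      and \<theta>t: "argmin_estimator M \<Theta> n0 U \<theta>t" for \<theta>t
    unfolding conv_in_prob_def
  proof (intro allI impI)
    fix \<eta> :: real assume "\<eta> > 0"
    obtain A where A: "A \<subseteq> I" "I - A \<in> null_sets lebesgue"
      and conv: "conv_in_prob M (\<lambda>n \<omega>. SUP t\<in>A. \<bar>Jh n t \<omega> - J t \<theta>0\<bar>) 0"
      using uc unfolding uniformly_consistent_def by blast
    obtain \<delta> where "\<delta> > 0" and \<delta>: "\<And>j \<theta>. good j \<Longrightarrow>
        is_arg_min (contrast I w c j J) (\<lambda>\<theta>. \<theta> \<in> \<Theta>) \<theta> \<Longrightarrow>
        dist (SUP t\<in>A. \<bar>j t - J t \<theta>0\<bar>) 0 \<le> \<delta> \<Longrightarrow> dist \<theta> \<theta>0 < \<eta>"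
      using key[OF \<open>\<eta> > 0\<close>] A by blast
    let ?E = "\<lambda>n. {\<omega> \<in> space M. dist (\<theta>t n \<omega>) \<theta>0 > \<eta>}"
    let ?F = "\<lambda>n. {\<omega> \<in> space M. dist (SUP t\<in>A. \<bar>Jh n t \<omega> - J t \<theta>0\<bar>) 0 > \<delta>}"
    \<comment> \<open>Contrapositive of \<open>key\<close>: outside a null set, a minimiser far from
      \<open>\<theta>0\<close> forces the supremum above \<open>\<delta>\<close>.\<close>
    have le: "outer_measure_of M (?E n) \<le> outer_measure_of M (?F n)" if n: "n \<ge> n0" for n
    proof (rule outer_measure_of_le_AE)
      have "AE \<omega> in M. is_arg_min (contrast I w c (\<lambda>t. Jh n t \<omega>) J) (\<lambda>\<theta>. \<theta> \<in> \<Theta>) (\<theta>t n \<omega>)"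
        using \<theta>t n unfolding argmin_estimator_def U_def I_def by blast
      then show "AE \<omega> in M. \<omega> \<in> ?E n \<longrightarrow> \<omega> \<in> ?F n"
        using good[OF n]
      proof eventually_elim
        case (elim \<omega>)
        show ?case using \<delta>[OF elim(2,1)] by force
      qed
    qed auto
    show "(\<lambda>n. outer_measure_of M (?E n)) \<longlonglongrightarrow> 0"
    proof (rule tendsto_sandwich[OF _ _ tendsto_const])
      show "(\<lambda>n. outer_measure_of M (?F n)) \<longlonglongrightarrow> 0"
        using conv \<open>\<delta> > 0\<close> unfolding conv_in_prob_def by blast
      show "\<forall>\<^sub>F n in sequentially. outer_measure_of M (?E n) \<le> outer_measure_of M (?F n)"
        using eventually_ge_at_top[of n0] by eventually_elim (rule le)
    qed auto
  qed

  \<comment> \<open>Strong consistency\<close>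
  moreover have "conv_almost_surely M \<theta>t \<theta>0"
    if uc: "uniformly_consistent (conv_almost_surely M) I Jh (\<lambda>t. J t \<theta>0)"
      and \<theta>t: "argmin_estimator M \<Theta> n0 U \<theta>t" for \<theta>t
  proof -
    obtain A where A: "A \<subseteq> I" "I - A \<in> null_sets lebesgue"
      and conv: "AE \<omega> in M. (\<lambda>n. SUP t\<in>A. \<bar>Jh n t \<omega> - J t \<theta>0\<bar>) \<longlonglongrightarrow> 0"
      using uc unfolding uniformly_consistent_def conv_almost_surely_def by blast
    \<comment> \<open>There are countably many ranks, so a single null set serves for all of them
      and the rest of the argument runs path by path.\<close>
    have "AE \<omega> in M. \<forall>n. n \<ge> n0 \<longrightarrow> good (\<lambda>t. Jh n t \<omega>)"
      using good by (auto simp: AE_all_countable)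
    moreover have "AE \<omega> in M. \<forall>n. n \<ge> n0 \<longrightarrow>
        is_arg_min (contrast I w c (\<lambda>t. Jh n t \<omega>) J) (\<lambda>\<theta>. \<theta> \<in> \<Theta>) (\<theta>t n \<omega>)"
      using \<theta>t unfolding argmin_estimator_def U_def I_def by (auto simp: AE_all_countable)
    ultimately show ?thesis
      unfolding conv_almost_surely_def using conv
    proof eventually_elim
      case (elim \<omega>)
      show ?case
      proof (rule tendstoI)
        fix \<eta> :: real assume "\<eta> > 0"
        obtain \<delta> where "\<delta> > 0" and \<delta>: "\<And>j \<theta>. good j \<Longrightarrow>
            is_arg_min (contrast I w c j J) (\<lambda>\<theta>. \<theta> \<in> \<Theta>) \<theta> \<Longrightarrow>
            dist (SUP t\<in>A. \<bar>j t - J t \<theta>0\<bar>) 0 \<le> \<delta> \<Longrightarrow> dist \<theta> \<theta>0 < \<eta>"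
          using key[OF \<open>\<eta> > 0\<close>] A by blast
        show "\<forall>\<^sub>F n in sequentially. dist (\<theta>t n \<omega>) \<theta>0 < \<eta>"
          using tendstoD[OF elim(3) \<open>\<delta> > 0\<close>] eventually_ge_at_top[of n0]
          by eventually_elim (use elim(1,2) in \<open>auto intro!: \<delta>\<close>)
      qed
    qed
  qed
  ultimately show ?thesis using ex unfolding I_def by blast
qed

end
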